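(* Let $\bm F\in\mathbb R^{n\times m}$ be such that $\bm Q=\bm F\bm F^\top$ is invertible, and let $Z=\{0,1\}^n$. Suppose that $\mathrm{supp}(\bm Q)$ is a connected rooted tree with $k$ leaves, whose nodes $1,\dots,n$ are labeled so that every node has a label smaller than that of its parent (so the root is $n$). Then the number of nodes in the exact decision diagram for $X_{\bm F}$ constructed by processing the variables in the order $1,2,\dots,n$ of this labeling is at most $$n\left(\frac{n-1}{k}+2\right)^k=\mathcal O(n^{k+1}).$$
   Context: $\mathrm{supp}(\bm Q)$ is the simple graph on vertex set $\{1,\dots,n\}$ with an edge $(i,j)$, $i\ne j$, iff $Q_{ij}\neq0$. A leaf of a rooted tree is a node without children (so a path rooted at one of its ends has one leaf, and the one-node tree has one leaf). $X_{\bm F}=\{(x_0,\bm x,\bm z)\in\mathbb R\times\mathbb R^n\times\{0,1\}^n:\ \|\bm F^\top\bm x\|_2^2\le x_0,\ x_i(1-z_i)=0\ \forall i\}$. For a matrix $\bm H$, $\bm H_\downarrow$ denotes $\bm H$ with its first row deleted. The exact decision diagram for $X_{\bm F}$ (case $Z=\{0,1\}^n$) is a layered directed multigraph with layers $1,\dots,n+1$. Layer 1 contains one node, storing the matrix $\bm F$. Nodes of layer $\ell$ are identified with the matrices $\bm H\in\mathbb R^{(n+1-\ell)\times m}$ they store (equal matrices in the same layer are the same node; at layer $n+1$ there is the single empty matrix). From each node $\bm H$ of layer $\ell\le n$, with first row $\bm u^\top$, there are two arcs to layer $\ell+1$, one for each decision $\bar z\in\{0,1\}$ for $z_\ell$: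 if $\bar z=0$, or if $\bar z=1$ and $\bm u=\bm 0$, the head is $\bm H_\downarrow$; if $\bar z=1$ and $\bm u\neq\bm 0$, the head is $\bm H_\downarrow(\bm I-\bm u\bm u^\top/\|\bm u\|_2^2)$. The nodes of the diagram are all those reachable from layer 1. *)

theory Defs
  imports
    "Jordan_Normal_Form.Matrix"
    "Graph_Theory.Graph_Theory"
    "HOL-Library.Landau_Symbols"
begin

text \<open>
  As usual in \<^theory>\<open>Graph_Theory.Digraph\<close>, an undirected simple graph is a symmetric
  digraph with one arc in each direction per edge. Vertices are numbered from 1,
  matrix indices from 0.
\<close>

definition supp_graph :: "real mat \<Rightarrow> (nat, nat \<times> nat) pre_digraph" where
  "supp_graph Q = with_proj
     \<lparr>pverts = {1..dim_row Q},
      parcs = {(i, j). i \<in> {1..dim_row Q} \<and> j \<in> {1..dim_row Q} \<and> i \<noteq> j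
                 \<and> Q $$ (i - 1, j - 1) \<noteq> 0}\<rparr>"

text \<open>
  The library's \<^const>\<open>tree\<close> excludes directed cycles; in a symmetric digraph every edge
  is a directed cycle of length 2. The undirected cycles are the directed ones of length
  at least 3.
\<close>

definition undirected_tree :: "('a, 'b) pre_digraph \<Rightarrow> bool" where
  "undirected_tree G \<longleftrightarrow> graph G \<and> connected G
     \<and> \<not> (\<exists>p. pre_digraph.cycle G p \<and> length p \<ge> 3)"

definition rooted_tree :: "('a, 'b) pre_digraph \<Rightarrow> 'a \<Rightarrow> bool" where
  "rooted_tree G r \<longleftrightarrow> undirected_tree G \<and> r \<in> verts G"

text \<open>The parent of \<open>v\<close> is the second vertex on the path from \<open>v\<close> to the root.\<close>

definition is_parent :: "('a, 'b) pre_digraph \<Rightarrow> 'a \<Rightarrow> 'a \<Rightarrow> 'a \<Rightarrow> bool" where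
  "is_parent G r p v \<longleftrightarrow> (\<exists>e es. pre_digraph.apath G v (e # es) r \<and> head G e = p)"

definition leaves :: "('a, 'b) pre_digraph \<Rightarrow> 'a \<Rightarrow> 'a set" where
  "leaves G r = {u \<in> verts G. \<not> (\<exists>v. is_parent G r u v)}"

definition delete_first_row :: "real mat \<Rightarrow> real mat" where
  "delete_first_row H = mat (dim_row H - 1) (dim_col H) (\<lambda>(i, j). H $$ (Suc i, j))"

definition outer_prod :: "real vec \<Rightarrow> real vec \<Rightarrow> real mat" where
  "outer_prod u v = mat (dim_vec u) (dim_vec v) (\<lambda>(i, j). u $ i * v $ j)"

definition next_mat :: "real mat \<Rightarrow> bool \<Rightarrow> real mat" where
  "next_mat H z =
     (let u = row H 0 in
      if z \<and> u \<noteq> 0\<^sub>v (dim_col H)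
      then delete_first_row H * (1\<^sub>m (dim_col H) - (1 / (u \<bullet> u)) \<cdot>\<^sub>m outer_prod u u)
      else delete_first_row H)"

text \<open>
  Nodes are pairs of a layer and a stored matrix. An arc is given by its tail and the
  decision it represents, so that two arcs may be parallel.
\<close>

inductive_set dd_nodes :: "real mat \<Rightarrow> (nat \<times> real mat) set" for F where
  root: "(1, F) \<in> dd_nodes F"
| step: "(l, H) \<in> dd_nodes F \<Longrightarrow> l \<le> dim_row F \<Longrightarrow> (Suc l, next_mat H z) \<in> dd_nodes F"

definition decision_diagram ::
    "real mat \<Rightarrow> (nat \<times> real mat, (nat \<times> real mat) \<times> bool) pre_digraph" where
  "decision_diagram F =
     \<lparr>verts = dd_nodes F,
      arcs = {((l, H), z) | l H z. (l, H) \<in> dd_nodes F \<and> l \<le> dim_row F},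
      tail = fst,
      head = (\<lambda>((l, H), z). (Suc l, next_mat H z))\<rparr>"

end

(*
  The matrix stored after the decisions A consists of the residuals of the rows still to
  come after orthogonal projection onto the span of the rows in A. Components of A in the
  support forest span mutually orthogonal spaces, and a later row is orthogonal to every
  component that is not joined to it through its top vertex. Hence the stored matrix only
  depends on the vertices of A that are connected inside A to an unprocessed vertex, a set
  closed under taking parents. Cutting the tree into k chains, one ending in each leaf,
  such a set is determined by the sizes of its intersections with the chains; by AM-GM
  layer l, for l at most n, has at most ((l - 1) / k + 1)^k nodes.
*)

theory Submission
  imports Defs "HOL-Analysis.Convex"
begin

unbundle no inner_syntax

section \<open>Residuals of orthogonal projections\<close>

text \<open>For vectors of dimension \<open>m\<close>, \<open>x\<close> is the projection of
  \<open>v\<close> onto the orthogonal complement of the span of the \<open>f a\<close>. The last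
  clause says that \<open>v - x\<close> is orthogonal to that complement, which avoids handling
  spans and bases.\<close>

definition is_residual ::
    "nat \<Rightarrow> ('a \<Rightarrow> real vec) \<Rightarrow> 'a set \<Rightarrow> real vec \<Rightarrow> real vec \<Rightarrow> bool" where
  "is_residual m f A v x \<longleftrightarrow> x \<in> carrier_vec m \<and> (\<forall>a\<in>A. x \<bullet> f a = 0)
     \<and> (\<forall>w\<in>carrier_vec m. (\<forall>a\<in>A. w \<bullet> f a = 0) \<longrightarrow> w \<bullet> v = w \<bullet> x)"

lemma scalar_prod_self_eq_0_iff:
  fixes x :: "real vec"
  assumes "x \<in> carrier_vec m"
  shows "x \<bullet> x = 0 \<longleftrightarrow> x = 0\<^sub>v m"
proof
  assume "x \<bullet> x = 0"
  then have "(\<Sum>i = 0..<m. x $ i * x $ i) = 0"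
    using assms by (simp add: scalar_prod_def)
  then have "\<forall>i\<in>{0..<m}. x $ i * x $ i = 0"
    by (subst (asm) sum_nonneg_eq_0_iff) auto
  then show "x = 0\<^sub>v m" using assms by (intro eq_vecI) auto
qed (use assms in auto)

text \<open>The difference of two residuals is orthogonal to every \<open>f a\<close>, so it is an
  admissible test vector \<open>w\<close>. Testing with it makes its own square norm vanish.\<close>

lemma is_residual_unique:
  assumes x: "is_residual m f A v x" and y: "is_residual m f A v y"
    and f: "\<And>a. a \<in> A \<Longrightarrow> f a \<in> carrier_vec m"
  shows "x = y"
proof -
  have [simp]: "x \<in> carrier_vec m" "y \<in> carrier_vec m"
    using x y by (auto simp: is_residual_def)
  let ?w = "x - y"
  have w: "?w \<in> carrier_vec m" "\<forall>a\<in>A. ?w \<bullet> f a = 0"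
    using x y f by (auto simp: is_residual_def minus_scalar_prod_distrib[of _ m])
  then have "?w \<bullet> v = ?w \<bullet> x" "?w \<bullet> v = ?w \<bullet> y"
    using x y by (auto simp: is_residual_def)
  then have "?w \<bullet> ?w = 0"
    using w(1) by (simp add: scalar_prod_minus_distrib[of _ m])
  then have "?w = 0\<^sub>v m"
    using scalar_prod_self_eq_0_iff w(1) by blast
  then have "x $ i = y $ i" if "i < m" for i
    using that by (metis \<open>x \<in> _\<close> \<open>y \<in> _\<close> carrier_vecD index_minus_vec(1) index_zero_vec(1) eq_iff_diff_eq_0)
  then show "x = y"
    by (metis \<open>x \<in> _\<close> \<open>y \<in> _\<close> carrier_vecD eq_vecI)
qed

lemma is_residual_empty:
  "v \<in> carrier_vec m \<Longrightarrow> is_residual m f {} v v"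
  by (simp add: is_residual_def)

text \<open>A zero residual means that \<open>f l\<close> already lies in the span, so the
  orthogonal complement does not shrink.\<close>

lemma is_residual_insert_zero:
  assumes x: "is_residual m f A v x" and u: "is_residual m f A (f l) (0\<^sub>v m)"
  shows "is_residual m f (insert l A) v x"
  using x u by (auto simp: is_residual_def)

text \<open>A Gram-Schmidt step: \<open>u\<close> is the new direction contributed by
  \<open>f l\<close>, and the component of \<open>x\<close> along it is removed.\<close>

lemma is_residual_insert:
  assumes x: "is_residual m f A v x" and u: "is_residual m f A (f l) u"
    and "u \<noteq> 0\<^sub>v m" and f: "\<And>a. a \<in> insert l A \<Longrightarrow> f a \<in> carrier_vec m"
  shows "is_residual m f (insert l A) v (x - (1 / (u \<bullet> u) * (x \<bullet> u)) \<cdot>\<^sub>v u)"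
proof -
  define c where "c = 1 / (u \<bullet> u) * (x \<bullet> u)"
  let ?y = "x - c \<cdot>\<^sub>v u"
  have [simp]: "x \<in> carrier_vec m" "u \<in> carrier_vec m"
    using x u by (auto simp: is_residual_def)
  have "u \<bullet> u \<noteq> 0"
    using \<open>u \<noteq> 0\<^sub>v m\<close> scalar_prod_self_eq_0_iff[of u m] by simp
  have yA: "\<forall>a\<in>A. ?y \<bullet> f a = 0"
    using x u f
    by (auto simp: is_residual_def minus_scalar_prod_distrib[of _ m] smult_scalar_prod_distrib[of _ m])
  have "?y \<bullet> u = 0"
    using \<open>u \<bullet> u \<noteq> 0\<close> by (simp add: minus_scalar_prod_distrib[of _ m] c_def)
  \<comment> \<open>\<open>?y\<close> is orthogonal to the vectors of \<open>A\<close>, so it may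
    serve as test vector for the residual \<open>u\<close> of \<open>f l\<close>.\<close>
  moreover have "?y \<bullet> f l = ?y \<bullet> u"
    using u yA by (auto simp: is_residual_def)
  moreover have "w \<bullet> v = w \<bullet> ?y"
    if w: "w \<in> carrier_vec m" "\<forall>a\<in>insert l A. w \<bullet> f a = 0" for w
  proof -
    have "w \<bullet> u = 0" "w \<bullet> v = w \<bullet> x"
      using x u w by (auto simp: is_residual_def)
    then show ?thesis using w(1) by (simp add: scalar_prod_minus_distrib[of _ m])
  qed
  ultimately show ?thesis
    using yA by (auto simp: is_residual_def c_def)
qed

text \<open>For \<open>a\<close> outside \<open>B\<close>, the vector \<open>f a\<close> is itself a
  test vector for \<open>B\<close>. This turns its orthogonality to \<open>v\<close> into
  orthogonality to \<open>x\<close>.\<close>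

lemma is_residual_superset:
  assumes x: "is_residual m f B v x" and "B \<subseteq> A"
    and f: "\<And>a. a \<in> A \<Longrightarrow> f a \<in> carrier_vec m" and v: "v \<in> carrier_vec m"
    and orth: "\<And>a. a \<in> A - B \<Longrightarrow> f a \<bullet> v = 0"
    and orth': "\<And>a b. a \<in> A - B \<Longrightarrow> b \<in> B \<Longrightarrow> f a \<bullet> f b = 0"
  shows "is_residual m f A v x"
proof -
  have [simp]: "x \<in> carrier_vec m"
    using x by (auto simp: is_residual_def)
  have "x \<bullet> f a = 0" if "a \<in> A" for a
  proof (cases "a \<in> B")
    case False
    then have "f a \<bullet> v = f a \<bullet> x"
      using x orth' f that by (auto simp: is_residual_def)
    then show ?thesis
      using orth[of a] f[of a] that False comm_scalar_prod[of x m "f a"] by auto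
  qed (use x in \<open>auto simp: is_residual_def\<close>)
  moreover have "\<forall>a\<in>B. w \<bullet> f a = 0" if "\<forall>a\<in>A. w \<bullet> f a = 0" for w
    using that \<open>B \<subseteq> A\<close> by blast
  ultimately show ?thesis
    using x by (simp add: is_residual_def)
qed

section \<open>The matrices stored in the diagram\<close>

lemma row_delete_first_row:
  assumes "H \<in> carrier_mat (Suc d) m" "i < d"
  shows "row (delete_first_row H) i = row H (Suc i)"
  using assms by (intro eq_vecI) (auto simp: delete_first_row_def)

lemma delete_first_row_carrier:
  "H \<in> carrier_mat (Suc d) m \<Longrightarrow> delete_first_row H \<in> carrier_mat d m"
  by (auto simp: delete_first_row_def)

text \<open>For c = 1 / (u \<bullet> u) the right side has the form of the update in
  \<open>is_residual_insert\<close>.\<close>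

lemma row_mult_projection:
  assumes D: "D \<in> carrier_mat d m" and u: "u \<in> carrier_vec m" and "i < d"
  shows "row (D * (1\<^sub>m m - c \<cdot>\<^sub>m outer_prod u u)) i
    = row D i - (c * (row D i \<bullet> u)) \<cdot>\<^sub>v u"
proof -
  have O: "outer_prod u u \<in> carrier_mat m m"
    using u by (auto simp: outer_prod_def)
  have "D * (1\<^sub>m m - c \<cdot>\<^sub>m outer_prod u u) = D - c \<cdot>\<^sub>m (D * outer_prod u u)"
    using D O by (simp add: mult_minus_distrib_mat[of _ d m _ m] mult_smult_distrib[of _ d m _ m])
  moreover have "(D * outer_prod u u) $$ (i, j) = (row D i \<bullet> u) * u $ j" if "j < m" for j
    using D O u \<open>i < d\<close> that
    by (simp add: scalar_prod_def outer_prod_def sum_distrib_right mult.assoc)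
  ultimately show ?thesis
    using D O u \<open>i < d\<close> by (intro eq_vecI) auto
qed

text \<open>Row \<open>i\<close> of a matrix in layer \<open>l\<close> belongs to vertex
  \<open>l + i\<close>. Vertices count from 1 and rows from 0, so its original is row
  \<open>l + i - 1\<close> of \<open>F\<close>.\<close>

definition stores_residuals :: "real mat \<Rightarrow> nat set \<Rightarrow> nat \<Rightarrow> real mat \<Rightarrow> bool" where
  "stores_residuals F A l H \<longleftrightarrow> H \<in> carrier_mat (dim_row F + 1 - l) (dim_col F)
     \<and> (\<forall>i < dim_row F + 1 - l.
          is_residual (dim_col F) (\<lambda>a. row F (a - 1)) A (row F (l + i - 1)) (row H i))"

lemma stores_residuals_initial: "stores_residuals F {} 1 F"
  by (auto simp: stores_residuals_def is_residual_empty)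

lemma stores_residuals_unique:
  assumes H: "stores_residuals F A l H" and H': "stores_residuals F A l H'"
  shows "H = H'"
proof (rule eq_rowI)
  fix i assume "i < dim_row H'"
  then have "i < dim_row F + 1 - l"
    using H' by (auto simp: stores_residuals_def)
  then show "row H i = row H' i"
    using H H' is_residual_unique[of "dim_col F" "\<lambda>a. row F (a - 1)" A]
    by (auto simp: stores_residuals_def)
qed (use H H' in \<open>auto simp: stores_residuals_def\<close>)

text \<open>The first row of \<open>H\<close> is the residual of vertex \<open>l\<close>. The three
  cases are decision 0, a row already in the span, and a Gram-Schmidt step.\<close>

lemma stores_residuals_next_mat:
  assumes H: "stores_residuals F A l H" and l: "1 \<le> l" "l \<le> dim_row F"
  shows "stores_residuals F (if z then insert l A else A) (Suc l) (next_mat H z)"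
proof -
  let ?m = "dim_col F" and ?f = "\<lambda>a. row F (a - 1)" and ?d = "dim_row F - l"
  let ?D = "delete_first_row H"
  define u where "u = row H 0"
  have H_carrier: "H \<in> carrier_mat (Suc ?d) ?m"
    using H l by (simp add: stores_residuals_def Suc_diff_le)
  have D_carrier: "?D \<in> carrier_mat ?d ?m"
    using H_carrier by (rule delete_first_row_carrier)
  have u_carrier: "u \<in> carrier_vec ?m"
    using row_carrier[of H 0] H_carrier by (simp add: u_def)
  have u: "is_residual ?m ?f A (?f l) u"
    using H l unfolding stores_residuals_def u_def by (metis add_0_right zero_less_diff less_Suc_eq_le Suc_eq_plus1)
  have D: "is_residual ?m ?f A (row F (l + i)) (row ?D i)" if "i < ?d" for i
  proof -
    have "is_residual ?m ?f A (row F (l + Suc i - 1)) (row H (Suc i))"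
      using H l that unfolding stores_residuals_def by (metis Suc_diff_le Suc_eq_plus1 Suc_less_eq)
    then show ?thesis
      by (simp add: row_delete_first_row[OF H_carrier that])
  qed
  consider "\<not> z" | "z" "u = 0\<^sub>v ?m" | "z" "u \<noteq> 0\<^sub>v ?m" by blast
  then show ?thesis
  proof cases
    case 1
    then show ?thesis using D D_carrier
      by (simp add: stores_residuals_def next_mat_def)
  next
    case 2
    then show ?thesis using D D_carrier H_carrier u is_residual_insert_zero
      by (fastforce simp add: stores_residuals_def next_mat_def u_def[symmetric])
  next
    case 3
    let ?E = "?D * (1\<^sub>m ?m - (1 / (u \<bullet> u)) \<cdot>\<^sub>m outer_prod u u)"
    have "is_residual ?m ?f (insert l A) (row F (l + i)) (row ?E i)" if "i < ?d" for i
      unfolding row_mult_projection[OF D_carrier u_carrier that]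
      using D[OF that] u 3(2) by (rule is_residual_insert) auto
    moreover have "next_mat H z = ?E"
      using 3 H_carrier by (simp add: next_mat_def u_def Let_def)
    moreover have "?E \<in> carrier_mat ?d ?m"
      using D_carrier u_carrier by (auto simp: outer_prod_def)
    ultimately show ?thesis
      using 3 by (simp add: stores_residuals_def)
  qed
qed

text \<open>The diagram itself computes the residuals for \<open>B\<close>: follow the arcs whose
  decisions record membership in \<open>B\<close>.\<close>

lemma stores_residuals_exists:
  assumes "B \<subseteq> {1..l}" "l \<le> dim_row F"
  shows "\<exists>H. stores_residuals F B (Suc l) H"
  using assms
proof (induction l arbitrary: B)
  case 0
  then show ?case using stores_residuals_initial by auto
next
  case (Suc l)
  then have "B - {Suc l} \<subseteq> {1..l}" by (auto simp: le_Suc_eq)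
  with Suc obtain H where "stores_residuals F (B - {Suc l}) (Suc l) H" by fastforce
  moreover have "(if Suc l \<in> B then insert (Suc l) (B - {Suc l}) else B - {Suc l}) = B"
    by auto
  ultimately show ?case
    using stores_residuals_next_mat[of F "B - {Suc l}" "Suc l" H "Suc l \<in> B"] Suc.prems by auto
qed

text \<open>The witness \<open>A\<close> collects the vertices that received decision 1 on a path to
  the node.\<close>

lemma dd_nodes_stores_residuals:
  assumes "(l, H) \<in> dd_nodes F"
  shows "1 \<le> l \<and> l \<le> dim_row F + 1 \<and> (\<exists>A\<subseteq>{1..<l}. stores_residuals F A l H)"
  using assms
proof (induction rule: dd_nodes.induct)
  case root
  then show ?case using stores_residuals_initial by auto
next
  case (step l H z)
  then obtain A where A: "A \<subseteq> {1..<l}" "stores_residuals F A l H" by blast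
  moreover have "(if z then insert l A else A) \<subseteq> {1..<Suc l}"
    using A step by auto
  ultimately show ?case
    using stores_residuals_next_mat[of F A l H z] step by auto
qed

section \<open>Upward closed sets in a forest\<close>

text \<open>The pairs of \<open>P\<close> are the arcs from a vertex to its parent.\<close>

definition up_closed :: "(nat \<times> nat) set \<Rightarrow> nat \<Rightarrow> nat set \<Rightarrow> bool" where
  "up_closed P l B \<longleftrightarrow> B \<subseteq> {1..<l} \<and> (\<forall>(v, p)\<in>P. v \<in> B \<longrightarrow> p < l \<longrightarrow> p \<in> B)"

text \<open>Labels grow along \<open>P\<close>, so the intermediate vertices are below
  \<open>l\<close> too and closure applies at each arc.\<close>

lemma up_closed_rtrancl:
  assumes "up_closed P l B" "\<And>v p. (v, p) \<in> P \<Longrightarrow> v < p"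
    and "(v, w) \<in> P\<^sup>*" "v \<in> B" "w < l"
  shows "w \<in> B"
  using assms(3-5)
proof (induction rule: rtrancl_induct)
  case (step y z)
  then show ?case using assms(1,2) by (force simp: up_closed_def)
qed

lemma rtrancl_increasing_le:
  fixes P :: "(nat \<times> nat) set"
  assumes "(v, w) \<in> P\<^sup>*" "\<And>v p. (v, p) \<in> P \<Longrightarrow> v < p"
  shows "v \<le> w"
  using assms(1) by induction (auto dest: assms(2))

text \<open>Moving from a vertex to a child lowers the label, so the descent ends, and it ends in a
  vertex without children.\<close>

lemma exists_leaf_below:
  fixes P :: "(nat \<times> nat) set"
  assumes "P \<subseteq> V \<times> V" "\<And>v p. (v, p) \<in> P \<Longrightarrow> v < p" "v \<in> V"
  shows "\<exists>u\<in>V - Range P. (u, v) \<in> P\<^sup>*"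
  using assms(3)
proof (induction v rule: less_induct)
  case (less v)
  show ?case
  proof (cases "v \<in> Range P")
    case True
    then obtain w where w: "(w, v) \<in> P" by blast
    then have "w < v" "w \<in> V" using assms(1,2) by auto
    then obtain u where "u \<in> V - Range P" "(u, w) \<in> P\<^sup>*" using less.IH by blast
    with w show ?thesis by (blast intro: rtrancl_into_rtrancl)
  qed (use less in blast)
qed

lemma prod_le_mean_power:
  fixes x :: "'a \<Rightarrow> real"
  assumes "finite S" "S \<noteq> {}" "\<And>i. i \<in> S \<Longrightarrow> x i \<ge> 0"
  shows "(\<Prod>i\<in>S. x i) \<le> ((\<Sum>i\<in>S. x i) / card S) ^ card S"
proof -
  have c: "card S > 0" using assms by (simp add: card_gt_0_iff)
  have p: "(\<Prod>i\<in>S. x i) \<ge> 0" using assms by (simp add: prod_nonneg)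
  have "((\<Prod>i\<in>S. x i) powr (1 / card S)) ^ card S \<le> ((\<Sum>i\<in>S. x i) / card S) ^ card S"
    using arith_geom_mean[OF assms] by (intro power_mono) (auto simp: sum_divide_distrib)
  also have "((\<Prod>i\<in>S. x i) powr (1 / card S)) ^ card S = (\<Prod>i\<in>S. x i)"
    using c p by (cases "(\<Prod>i\<in>S. x i) = 0") (simp_all add: powr_power)
  finally show ?thesis .
qed

text \<open>
  Assign to each vertex some leaf below it. The vertices with a common leaf form a chain,
  and an upward closed set meets it in a final segment, which is known from its size.
\<close>

lemma card_up_closed:
  fixes P :: "(nat \<times> nat) set" and n l :: nat
  defines "L \<equiv> {1..n} - Range P"
  assumes P: "P \<subseteq> {1..n} \<times> {1..n}" "single_valued P" "\<And>v p. (v, p) \<in> P \<Longrightarrow> v < p"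
    and l: "1 \<le> l" "l \<le> n"
  shows "real (card {B. up_closed P l B}) \<le> ((real l - 1) / card L + 1) ^ card L"
proof -
  have "\<forall>v\<in>{1..n}. \<exists>u. u \<in> L \<and> (u, v) \<in> P\<^sup>*"
    using exists_leaf_below[OF P(1,3)] unfolding L_def by blast
  then obtain g where g: "\<And>v. v \<in> {1..n} \<Longrightarrow> g v \<in> L \<and> (g v, v) \<in> P\<^sup>*"
    by (metis (full_types))
  define D where "D u = {v \<in> {1..<l}. g v = u}" for u
  have [simp]: "finite L" "finite (D u)" for u
    by (auto simp: L_def D_def)
  have "L \<noteq> {}" using g[of 1] l by auto
  have final: "w \<in> B" if B: "up_closed P l B" and "v \<in> D u" "w \<in> D u" "v \<in> B" "v \<le> w" for B u v w
  proof -
    have "(u, v) \<in> P\<^sup>*" "(u, w) \<in> P\<^sup>*" "w < l"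
      using that(2,3) g[of v] g[of w] l by (auto simp: D_def)
    \<comment> \<open>Parents are unique, so paths upwards do not branch: of two vertices above
      \<open>u\<close>, one lies above the other.\<close>
    then consider "(v, w) \<in> P\<^sup>*" | "(w, v) \<in> P\<^sup>*"
      using single_valued_confluent[OF P(2)] by blast
    then show ?thesis
    proof cases
      case 1
      then show ?thesis using up_closed_rtrancl B P(3) that \<open>w < l\<close> by blast
    next
      case 2
      then have "w \<le> v" using P(3) rtrancl_increasing_le by blast
      then show ?thesis using that by simp
    qed
  qed
  have D_union: "(\<Union>u\<in>L. D u) = {1..<l}"
    using g l by (auto simp: D_def)
  have "(\<Sum>u\<in>L. card (D u)) = card (\<Union>u\<in>L. D u)"
    by (subst card_UN_disjoint) (auto simp: D_def)
  then have sum_card: "(\<Sum>u\<in>L. card (D u)) = l - 1"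
    by (simp add: D_union)
  have union: "X = (\<Union>u\<in>L. X \<inter> D u)" if "up_closed P l X" for X
    using that D_union unfolding up_closed_def by blast
  \<comment> \<open>\<open>restrict\<close> fixes the value outside \<open>L\<close>, so the size
    vectors lie in a finite set of extensional functions.\<close>
  define \<phi> where "\<phi> B = restrict (\<lambda>u. card (B \<inter> D u)) L" for B
  have "inj_on \<phi> {B. up_closed P l B}"
  proof (rule inj_onI, simp)
    fix B C assume B: "up_closed P l B" and C: "up_closed P l C" and eq: "\<phi> B = \<phi> C"
    have "B \<inter> D u = C \<inter> D u" if "u \<in> L" for u
    proof -
      have "card (B \<inter> D u) = card (C \<inter> D u)"
        using fun_cong[OF eq, of u] that by (simp add: \<phi>_def)
      \<comment> \<open>Vertices \<open>v\<close> in \<open>B\<close> only and \<open>w\<close> in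
        \<open>C\<close> only cannot share a chain, since \<open>final\<close> would put the larger
        one into both sets. Nested traces of equal size coincide.\<close>
      moreover have "B \<inter> D u \<subseteq> C \<inter> D u \<or> C \<inter> D u \<subseteq> B \<inter> D u"
      proof (rule ccontr)
        assume "\<not> ?thesis"
        then obtain v w where "v \<in> B" "v \<in> D u" "v \<notin> C" "w \<in> C" "w \<in> D u" "w \<notin> B"
          by blast
        then show False
          using final[OF B, of v u w] final[OF C, of w u v] by linarith
      qed
      ultimately show ?thesis
        by (metis \<open>\<And>u. finite (D u)\<close> card_subset_eq finite_Int)
    qed
    then have "(\<Union>u\<in>L. B \<inter> D u) = (\<Union>u\<in>L. C \<inter> D u)" by simp
    from trans[OF union[OF B] this] union[OF C, symmetric] show "B = C" by (rule trans)
  qed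
  moreover have \<phi>_mem: "\<phi> B \<in> (\<Pi>\<^sub>E u\<in>L. {..card (D u)})" for B
    by (simp add: \<phi>_def card_mono)
  have "\<phi> ` {B. up_closed P l B} \<subseteq> (\<Pi>\<^sub>E u\<in>L. {..card (D u)})"
    using \<phi>_mem by blast
  moreover have "finite (\<Pi>\<^sub>E u\<in>L. {..card (D u)})"
    by (intro finite_PiE) auto
  ultimately have "card {B. up_closed P l B} \<le> card (\<Pi>\<^sub>E u\<in>L. {..card (D u)})"
    by (meson card_inj_on_le)
  also have "\<dots> = (\<Prod>u\<in>L. card (D u) + 1)"
    by (simp add: card_PiE)
  finally have "real (card {B. up_closed P l B}) \<le> (\<Prod>u\<in>L. real (card (D u)) + 1)"
    by (metis (mono_tags, lifting) of_nat_1 of_nat_add of_nat_le_iff of_nat_prod prod.cong)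
  \<comment> \<open>AM-GM is applied to the numbers of possible trace sizes, from 0 to
    \<open>card (D u)\<close>. Over all chains they sum to \<open>l - 1 + card L\<close>.\<close>
  also have "\<dots> \<le> ((\<Sum>u\<in>L. real (card (D u)) + 1) / card L) ^ card L"
    using \<open>L \<noteq> {}\<close> by (intro prod_le_mean_power) auto
  also have "(\<Sum>u\<in>L. real (card (D u)) + 1) = real l - 1 + card L"
    using sum_card l by (simp add: sum.distrib of_nat_diff flip: of_nat_sum)
  finally show ?thesis
    using \<open>L \<noteq> {}\<close> by (simp add: add_divide_distrib)
qed

text \<open>
  The vertices of \<open>A\<close> from which the path towards the root stays in \<open>A\<close> as long as it
  runs below \<open>l\<close>. The rows of the other vertices of \<open>A\<close> are orthogonal to the rows of
  these and to all rows still to come.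
\<close>

definition core :: "(nat \<times> nat) set \<Rightarrow> nat \<Rightarrow> nat set \<Rightarrow> nat set" where
  "core P l A = {a \<in> A. \<forall>b. (a, b) \<in> P\<^sup>* \<longrightarrow> b < l \<longrightarrow> b \<in> A}"

lemma up_closed_core: "A \<subseteq> {1..<l} \<Longrightarrow> up_closed P l (core P l A)"
  by (auto simp: up_closed_def core_def intro: converse_rtrancl_into_rtrancl)

text \<open>The path from \<open>a\<close> upwards leaves \<open>A\<close> while still below
  \<open>l\<close>. A parent in the core, or one that is at least \<open>l\<close>, would rule this
  out. So would a child in the core, whose path upwards runs through \<open>a\<close>; a child that
  is at least \<open>l\<close> contradicts the order of labels.\<close>

lemma not_in_core_no_arc:
  assumes P: "single_valued P" "\<And>v p. (v, p) \<in> P \<Longrightarrow> v < p"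
    and A: "A \<subseteq> {1..<l}" and a: "a \<in> A - core P l A" and b: "b \<in> core P l A \<or> l \<le> b"
  shows "(a, b) \<notin> P" "(b, a) \<notin> P"
proof
  assume ab: "(a, b) \<in> P"
  have "c \<in> A" if "(a, c) \<in> P\<^sup>*" "c < l" for c
    using that(1)
  proof (cases rule: converse_rtranclE)
    case base
    then show ?thesis using a by simp
  next
    case (step y)
    then have "(b, c) \<in> P\<^sup>*" using ab P(1) by (auto dest: single_valuedD)
    moreover then have "b \<le> c" using P(2) rtrancl_increasing_le by blast
    ultimately show ?thesis using b \<open>c < l\<close> by (auto simp: core_def)
  qed
  then show False using a by (auto simp: core_def)
next
  show "(b, a) \<notin> P"
  proof
    assume ba: "(b, a) \<in> P"
    then have "b < a" by (rule P(2))
    then have "b \<in> core P l A" using b a A by auto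
    then have "a \<in> core P l A"
      using ba a unfolding core_def by (blast intro: converse_rtrancl_into_rtrancl)
    then show False using a by simp
  qed
qed

text \<open>The matrix \<open>H'\<close> for the core also stores the residuals for
  \<open>A\<close>, because the discarded rows are orthogonal to the core rows and to all later
  rows. Uniqueness then identifies it with \<open>H\<close>.\<close>

lemma stores_residuals_core:
  assumes P: "single_valued P" "\<And>v p. (v, p) \<in> P \<Longrightarrow> v < p"
    and orth: "\<And>a b. \<lbrakk>a \<in> {1..dim_row F}; b \<in> {1..dim_row F}; a \<noteq> b; (a, b) \<notin> P; (b, a) \<notin> P\<rbrakk>
      \<Longrightarrow> row F (a - 1) \<bullet> row F (b - 1) = 0"
    and l: "1 \<le> l" "l \<le> dim_row F + 1"
    and A: "A \<subseteq> {1..<l}" and H: "stores_residuals F A l H"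
  shows "stores_residuals F (core P l A) l H"
proof -
  let ?B = "core P l A"
  have BA: "?B \<subseteq> A" by (auto simp: core_def)
  have orth_core: "row F (a - 1) \<bullet> row F (b - 1) = 0"
    if "a \<in> A - ?B" "b \<in> ?B \<or> l \<le> b \<and> b \<le> dim_row F" for a b
  proof (rule orth)
    show "(a, b) \<notin> P" "(b, a) \<notin> P"
      using not_in_core_no_arc[OF P A that(1)] that(2) by auto
  qed (use that BA A l in auto)
  obtain H' where H': "stores_residuals F ?B l H'"
    using stores_residuals_exists[of ?B "l - 1" F] BA A l by fastforce
  have "stores_residuals F A l H'"
    unfolding stores_residuals_def
  proof (intro conjI allI impI)
    fix i assume i: "i < dim_row F + 1 - l"
    then have "is_residual (dim_col F) (\<lambda>a. row F (a - 1)) ?B (row F (l + i - 1)) (row H' i)"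
      using H' by (auto simp: stores_residuals_def)
    moreover have orth_later: "row F (a - 1) \<bullet> row F (l + i - 1) = 0" if "a \<in> A - ?B" for a
      using i by (intro orth_core that) auto
    ultimately show "is_residual (dim_col F) (\<lambda>a. row F (a - 1)) A (row F (l + i - 1)) (row H' i)"
      by (intro is_residual_superset[OF _ BA]) (use orth_core orth_later in auto)
  qed (use H' in \<open>simp add: stores_residuals_def\<close>)
  with H have "H = H'" by (rule stores_residuals_unique)
  with H' show ?thesis by simp
qed

section \<open>Parents in an undirected tree\<close>

text \<open>The vertex set is recorded so that avoiding a given vertex carries over to the reversed
  walk.\<close>

lemma (in sym_digraph) awalk_reverse:
  assumes "awalk u p v"
  shows "\<exists>q. awalk v q u \<and> set (awalk_verts v q) = set (awalk_verts u p)"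
  using assms
proof (induction p arbitrary: u)
  case Nil
  then have "awalk v [] u \<and> set (awalk_verts v []) = set (awalk_verts u [])"
    by (auto simp: awalk_Nil_iff)
  then show ?case by blast
next
  case (Cons e es)
  then have e: "e \<in> arcs G" "tail G e = u" and es: "awalk (head G e) es v"
    by (auto simp: awalk_Cons_iff)
  obtain q where q: "awalk v q (head G e)"
      "set (awalk_verts v q) = set (awalk_verts (head G e) es)"
    using Cons.IH es by blast
  obtain f where f: "f \<in> arcs G" "tail G f = head G e" "head G f = u"
    using sym_arcs e unfolding symmetric_conv by metis
  then have af: "awalk (head G e) [f] u" by (auto simp: awalk_simps)
  have "head G e \<in> set (awalk_verts v q)"
    using q(2) hd_in_awalk_verts(1)[OF es] by simp
  then have "set (awalk_verts v (q @ [f])) = set (awalk_verts u (e # es))"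
    using set_awalk_verts_append[OF q(1) af] q(2) f e by auto
  then show ?case using awalk_appendI[OF q(1) af] by blast
qed

text \<open>Two distinct neighbours of \<open>v\<close> joined by a walk that avoids
  \<open>v\<close> would close up through \<open>v\<close> to a cycle with at least three
  arcs.\<close>

lemma undirected_tree_no_detour:
  assumes tree: "undirected_tree G" and e: "e \<in> arcs G" "tail G e = v"
    and f: "f \<in> arcs G" "head G f = v"
    and p: "pre_digraph.awalk G (head G e) p (tail G f)"
      "v \<notin> set (pre_digraph.awalk_verts G (head G e) p)"
  shows "head G e = tail G f"
proof (rule ccontr)
  assume ne: "head G e \<noteq> tail G f"
  interpret graph G using tree by (simp add: undirected_tree_def)
  define q where "q = awalk_to_apath p"
  have q: "apath (head G e) q (tail G f)"
    unfolding q_def using p(1) by (rule apath_awalk_to_apath)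
  then have aq: "awalk (head G e) q (tail G f)" by (rule awalkI_apath)
  \<comment> \<open>The shortened path uses only arcs of \<open>p\<close>, so it still avoids
    \<open>v\<close>.\<close>
  have "set q \<subseteq> set p"
    unfolding q_def using p(1) by (rule awalk_to_apath_subset)
  then have v: "v \<notin> set (awalk_verts (head G e) q)"
    using p(2) set_awalk_verts[OF p(1)] set_awalk_verts[OF aq] by auto
  have af: "awalk (tail G f) [f] v" using f by (auto simp: awalk_simps)
  have qf: "awalk (head G e) (q @ [f]) v" using awalk_appendI[OF aq af] .
  then have "awalk v (e # q @ [f]) v" using e by (simp only: awalk_Cons_iff simp_thms)
  moreover have "tl (awalk_verts v (e # q @ [f])) = awalk_verts (head G e) q @ [v]"
    using awalk_verts_append[OF qf] f by simp
  ultimately have "cycle (e # q @ [f])"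
    using q v by (auto simp: cycle_def apath_def)
  moreover have "q \<noteq> []" using aq ne by (auto simp: awalk_Nil_iff)
  then have "length (e # q @ [f]) \<ge> 3" by (cases q) auto
  ultimately show False using tree unfolding undirected_tree_def by blast
qed

lemma is_parent_in_verts:
  assumes "graph G" "is_parent G r p v"
  shows "p \<in> verts G" "v \<in> verts G"
proof -
  interpret graph G by fact
  show "p \<in> verts G" "v \<in> verts G"
    using assms(2) by (auto simp: is_parent_def apath_Cons_iff)
qed

text \<open>The tails of both paths to the root avoid \<open>v\<close>. Following one and then the
  other backwards joins the two parents by a walk that avoids \<open>v\<close>.\<close>

lemma is_parent_unique:
  assumes tree: "undirected_tree G" and p: "is_parent G r p v" and p': "is_parent G r p' v"
  shows "p = p'"
proof -
  interpret graph G using tree by (simp add: undirected_tree_def)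
  obtain e es where e: "apath v (e # es) r" "head G e = p"
    using p by (auto simp: is_parent_def)
  obtain e' es' where e': "apath v (e' # es') r" "head G e' = p'"
    using p' by (auto simp: is_parent_def)
  have es: "awalk p es r" "v \<notin> set (awalk_verts p es)" "e \<in> arcs G" "tail G e = v"
    using e by (auto simp: apath_Cons_iff awalkI_apath)
  have es': "awalk p' es' r" "v \<notin> set (awalk_verts p' es')" "e' \<in> arcs G" "tail G e' = v"
    using e' by (auto simp: apath_Cons_iff awalkI_apath)
  obtain f where f: "f \<in> arcs G" "tail G f = p'" "head G f = v"
    using sym_arcs es'(3,4) e'(2) unfolding symmetric_conv by metis
  obtain q where q: "awalk r q p'" "set (awalk_verts r q) = set (awalk_verts p' es')"
    using awalk_reverse es'(1) by blast
  have "awalk p (es @ q) p'" using es(1) q(1) by (rule awalk_appendI)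
  moreover have "v \<notin> set (awalk_verts p (es @ q))"
    using set_awalk_verts_append[OF es(1) q(1)] q(2) es(2) es'(2) by simp
  ultimately show ?thesis
    using undirected_tree_no_detour[OF tree es(3,4) f(1,3), of "es @ q"] e(2) f(2) by simp
qed

text \<open>Take the path from the tail to the root. If it misses the head, prepending the reverse
  arc makes the tail the parent. Otherwise its part from the second vertex to the head avoids the
  tail, which forces that second vertex to be the head.\<close>

lemma arc_is_parent:
  assumes tree: "rooted_tree G r" and e: "e \<in> arcs G"
  shows "is_parent G r (tail G e) (head G e) \<or> is_parent G r (head G e) (tail G e)"
proof -
  have tree': "undirected_tree G" and r: "r \<in> verts G"
    using tree by (auto simp: rooted_tree_def)
  interpret graph G using tree' by (simp add: undirected_tree_def)
  let ?i = "tail G e" and ?j = "head G e"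
  obtain f where f: "f \<in> arcs G" "tail G f = ?j" "head G f = ?i"
    using sym_arcs e unfolding symmetric_conv by metis
  have "strongly_connected G"
    using tree' sym_arcs symmetric_connected_imp_strongly_connected
    by (auto simp: undirected_tree_def)
  then have "?i \<rightarrow>\<^sup>*\<^bsub>G\<^esub> r" using e r by auto
  then obtain p where p: "apath ?i p r" using reachable_apath by blast
  show ?thesis
  proof (cases "?j \<in> set (awalk_verts ?i p)")
    case False
    then have "apath ?j (f # p) r"
      using p f by (simp add: apath_Cons_iff)
    then show ?thesis using f by (auto simp: is_parent_def)
  next
    case True
    then obtain g es where ges: "p = g # es"
      using no_loops[OF e] by (cases p) auto
    have g: "g \<in> arcs G" "tail G g = ?i" "apath (head G g) es r"
        "?i \<notin> set (awalk_verts (head G g) es)"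
      using p by (auto simp: ges apath_Cons_iff)
    have "?j \<in> set (awalk_verts (head G g) es)"
      using True no_loops[OF e] g(2) by (simp add: ges)
    then obtain q s where qs: "es = q @ s" "awalk (head G g) q ?j" "awalk ?j s r"
      using awalk_decomp[OF awalkI_apath[OF g(3)]] by blast
    have "?i \<notin> set (awalk_verts (head G g) q)"
      using g(4) set_awalk_verts_append[OF qs(2,3)] qs(1) by simp
    then have "head G g = ?j"
      using undirected_tree_no_detour[OF tree' g(1,2) f(1,3), of q] qs(2) f(2) by simp
    then show ?thesis using p by (auto simp: is_parent_def ges)
  qed
qed

section \<open>The bound\<close>

text \<open>This absorbs the single node of layer \<open>n + 1\<close> into the bound, and so
  accounts for the 2 where the layer bound has 1.\<close>

lemma power_plus_one_le:
  fixes c :: real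
  assumes "c \<ge> 0" "k \<ge> 1"
  shows "c ^ k + 1 \<le> (c + 1) ^ k"
proof -
  obtain j where k: "k = Suc j" using assms(2) by (cases k) auto
  have "c * c ^ j \<le> c * (c + 1) ^ j" "1 \<le> (c + 1) ^ j"
    using assms(1) by (auto intro!: mult_left_mono power_mono)
  then show ?thesis by (simp add: k algebra_simps)
qed

lemma bound_bigo:
  assumes "k \<ge> 1"
  shows "(\<lambda>N::nat. real N * ((real N - 1) / real k + 2) ^ k) \<in> O(\<lambda>N. real N ^ (k + 1))"
\<comment> \<open>The constant comes from bounding the base by \<open>3 * N\<close> for
  \<open>N\<close> at least 1, with \<open>k\<close> fixed.\<close>
proof (rule bigoI[where c = "3 ^ k"], rule eventually_mono[OF eventually_ge_at_top[of 1]])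
  fix N :: nat assume N: "1 \<le> N"
  have "(real N - 1) / real k \<le> real N - 1"
    using N assms mult_left_mono[of 1 "real k" "real N - 1"] by (simp add: divide_le_eq)
  then have "(real N - 1) / real k + 2 \<le> 3 * real N" using N by simp
  then have "((real N - 1) / real k + 2) ^ k \<le> (3 * real N) ^ k"
    using N by (intro power_mono) auto
  then have "real N * ((real N - 1) / real k + 2) ^ k \<le> real N * (3 * real N) ^ k"
    by (intro mult_left_mono) auto
  then show "norm (real N * ((real N - 1) / real k + 2) ^ k) \<le> 3 ^ k * norm (real N ^ (k + 1))"
    using N by (simp add: power_mult_distrib mult.left_commute)
qed

lemma supp_graph_simps:
  "verts (supp_graph Q) = {1..dim_row Q}"
  "tail (supp_graph Q) = fst" "head (supp_graph Q) = snd"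
  "(i, j) \<in> arcs (supp_graph Q) \<longleftrightarrow> i \<in> {1..dim_row Q} \<and> j \<in> {1..dim_row Q} \<and> i \<noteq> j
     \<and> Q $$ (i - 1, j - 1) \<noteq> 0"
  by (auto simp: supp_graph_def)

text \<open>Each node is recovered from the core of a decision set leading to it, so the upward
  closed sets map onto the layer.\<close>

lemma card_layer_le:
  assumes P: "single_valued P" "\<And>v p. (v, p) \<in> P \<Longrightarrow> v < p"
    and orth: "\<And>a b. \<lbrakk>a \<in> {1..dim_row F}; b \<in> {1..dim_row F}; a \<noteq> b; (a, b) \<notin> P; (b, a) \<notin> P\<rbrakk>
      \<Longrightarrow> row F (a - 1) \<bullet> row F (b - 1) = 0"
  shows "finite {H. (l, H) \<in> dd_nodes F}"
    and "card {H. (l, H) \<in> dd_nodes F} \<le> card {B. up_closed P l B}"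
proof -
  have "H \<in> (\<lambda>B. THE H. stores_residuals F B l H) ` {B. up_closed P l B}"
    if "(l, H) \<in> dd_nodes F" for H
  proof -
    from dd_nodes_stores_residuals[OF that] obtain A where
      l: "1 \<le> l" "l \<le> dim_row F + 1" and A: "A \<subseteq> {1..<l}" "stores_residuals F A l H"
      by blast
    have "stores_residuals F (core P l A) l H"
      using stores_residuals_core[OF P orth l A] by blast
    then have "(THE H. stores_residuals F (core P l A) l H) = H"
      using stores_residuals_unique by blast
    then show ?thesis using up_closed_core[OF A(1)] by force
  qed
  then have sub: "{H. (l, H) \<in> dd_nodes F}
      \<subseteq> (\<lambda>B. THE H. stores_residuals F B l H) ` {B. up_closed P l B}"
    by blast
  have fin: "finite {B. up_closed P l B}"
    by (rule finite_subset[of _ "Pow {1..<l}"]) (auto simp: up_closed_def)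
  show "finite {H. (l, H) \<in> dd_nodes F}"
    using sub fin finite_surj by blast
  show "card {H. (l, H) \<in> dd_nodes F} \<le> card {B. up_closed P l B}"
    using sub fin surj_card_le by blast
qed

theorem corollary1:
  fixes F :: "real mat" and n m k r :: nat
  assumes "F \<in> carrier_mat n m"
    and "invertible_mat (F * F\<^sup>T)"
    and "rooted_tree (supp_graph (F * F\<^sup>T)) r"
    and "card (leaves (supp_graph (F * F\<^sup>T)) r) = k"
    and "\<forall>v p. is_parent (supp_graph (F * F\<^sup>T)) r p v \<longrightarrow> v < p"
  shows "finite (verts (decision_diagram F))
    \<and> real (card (verts (decision_diagram F))) \<le> real n * ((real n - 1) / real k + 2) ^ k
    \<and> (\<lambda>N::nat. real N * ((real N - 1) / real k + 2) ^ k) \<in> O(\<lambda>N. real N ^ (k + 1))"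
proof -
  define G where "G = supp_graph (F * F\<^sup>T)"
  define P where "P = {(v, p). is_parent G r p v}"
  define L where "L = {1..n} - Range P"
  define N where "N l = {H. (l, H) \<in> dd_nodes F}" for l
  have dim: "dim_row F = n" "dim_col F = m" using assms(1) by auto
  have tree: "rooted_tree G r" using assms(3) by (simp add: G_def)
  then have tree': "undirected_tree G" and "r \<in> verts G" by (auto simp: rooted_tree_def)
  then have "graph G" by (simp add: undirected_tree_def)
  have verts: "verts G = {1..n}" using assms(1) by (simp add: G_def supp_graph_simps)
  then have "n \<ge> 1" using \<open>r \<in> verts G\<close> by simp
  have P: "P \<subseteq> {1..n} \<times> {1..n}" "single_valued P" and P_less: "\<And>v p. (v, p) \<in> P \<Longrightarrow> v < p"
    using is_parent_in_verts[OF \<open>graph G\<close>] is_parent_unique[OF tree'] assms(5) verts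
    by (auto simp: P_def G_def intro!: single_valuedI)
  have "leaves G r = L"
    by (auto simp: leaves_def L_def verts P_def)
  then have k: "card L = k" using assms(4) by (simp add: G_def)
  \<comment> \<open>A child of vertex 1 would need a smaller label.\<close>
  have "1 \<in> L" using P P_less \<open>n \<ge> 1\<close> by (force simp: L_def)
  then have "k \<ge> 1" using k by (metis L_def One_nat_def Suc_leI card_gt_0_iff empty_iff finite_Diff finite_atLeastAtMost)
  have orth: "row F (a - 1) \<bullet> row F (b - 1) = 0"
    if "a \<in> {1..dim_row F}" "b \<in> {1..dim_row F}" "a \<noteq> b" "(a, b) \<notin> P" "(b, a) \<notin> P" for a b
  proof -
    have "(a, b) \<notin> arcs G"
    proof
      assume "(a, b) \<in> arcs G"
      from arc_is_parent[OF tree this] that(4,5) show False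
        by (auto simp: P_def G_def supp_graph_simps)
    qed
    then have "(F * F\<^sup>T) $$ (a - 1, b - 1) = 0"
      using that(1-3) by (auto simp: G_def supp_graph_simps)
    then show ?thesis using that(1,2) by auto
  qed
  have finite_N: "finite (N l)" for l
    unfolding N_def by (rule card_layer_le(1)[OF P(2) P_less orth])
  \<comment> \<open>The base of the layer bound at \<open>l = n\<close>, which dominates all layers
    up to \<open>n\<close>.\<close>
  define c where "c = (real n - 1) / real k + 1"
  have "c \<ge> 0" using \<open>n \<ge> 1\<close> by (simp add: c_def)
  have card_N: "real (card (N l)) \<le> c ^ k" if "l \<in> {1..n}" for l
  proof -
    have "card (N l) \<le> card {B. up_closed P l B}"
      unfolding N_def by (rule card_layer_le(2)[OF P(2) P_less orth])
    also have "real \<dots> \<le> ((real l - 1) / card L + 1) ^ card L"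
      unfolding L_def using that by (intro card_up_closed P P_less) auto
    also have "\<dots> \<le> c ^ k"
      unfolding k c_def using that by (intro power_mono add_right_mono divide_right_mono) auto
    finally show ?thesis by simp
  qed
  \<comment> \<open>Layer \<open>n + 1\<close> is split off: it holds only the matrix without rows,
    which is unique.\<close>
  have "(l, H) \<in> (SIGMA l:{1..n}. N l) \<union> {(n + 1, 0\<^sub>m 0 m)}" if "(l, H) \<in> dd_nodes F" for l H
  proof (cases "l \<le> n")
    case False
    then have "l = n + 1" "H \<in> carrier_mat 0 m"
      using dd_nodes_stores_residuals[OF that] dim by (auto simp: stores_residuals_def)
    then show ?thesis by auto
  qed (use that dd_nodes_stores_residuals[OF that] in \<open>auto simp: N_def\<close>)
  then have sub: "dd_nodes F \<subseteq> (SIGMA l:{1..n}. N l) \<union> {(n + 1, 0\<^sub>m 0 m)}"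
    by (intro subrelI)
  have fin: "finite (SIGMA l:{1..n}. N l)" using finite_N by blast
  have "card (dd_nodes F) \<le> card ((SIGMA l:{1..n}. N l) \<union> {(n + 1, 0\<^sub>m 0 m)})"
    using sub fin by (intro card_mono) auto
  also have "\<dots> \<le> card (SIGMA l:{1..n}. N l) + 1"
    using card_Un_le[of "SIGMA l:{1..n}. N l" "{(n + 1, 0\<^sub>m 0 m)}"] by simp
  also have "\<dots> = (\<Sum>l = 1..n. card (N l)) + 1"
    using finite_N by simp
  also have "real \<dots> \<le> n * c ^ k + 1"
    using sum_bounded_above[of "{1..n}" "\<lambda>l. real (card (N l))" "c ^ k"] card_N by simp
  also have "\<dots> \<le> n * (c ^ k + 1)" using \<open>n \<ge> 1\<close> by (simp add: algebra_simps)
  also have "\<dots> \<le> n * (c + 1) ^ k"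
    using power_plus_one_le[OF \<open>c \<ge> 0\<close> \<open>k \<ge> 1\<close>] by (intro mult_left_mono) auto
  finally have "real (card (dd_nodes F)) \<le> n * ((real n - 1) / real k + 2) ^ k"
    by (simp add: c_def add.assoc)
  moreover have "finite (dd_nodes F)"
    using finite_subset[OF sub] fin by simp
  ultimately show ?thesis
    using bound_bigo[OF \<open>k \<ge> 1\<close>] by (simp add: decision_diagram_def)
qed

end
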